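(* Suppose that $\boldsymbol\Sigma_1,\dots,\boldsymbol\Sigma_T$ commute pairwise, and let $\boldsymbol U\in\mathbb R^{p\times p}$ be an orthogonal matrix, with columns $\boldsymbol u_1,\dots,\boldsymbol u_p$, such that $\boldsymbol\Sigma_t=\boldsymbol U\,\mathrm{diag}\{\gamma_1^{(t)},\dots,\gamma_p^{(t)}\}\,\boldsymbol U^\top$ for every $t\in[T]$. Suppose also that $\sum_{t=1}^T\gamma_j^{(t)}>0$ for each $j\in[p]$. Let $\boldsymbol H_t=\boldsymbol U\boldsymbol\Lambda_t\boldsymbol U^\top$ with $\boldsymbol\Lambda_t=\mathrm{diag}\{\lambda_1^{(t)},\dots,\lambda_p^{(t)}\}$ a real diagonal matrix satisfying $\lambda_j^{(t)}+\gamma_j^{(t)}>0$ for all $j\in[p]$, $t\in[T]$. Let $\widehat{\boldsymbol w}_t^{(\mathrm{GR})}$ be the generalized $\ell_2$-regularized estimators with weight matrices $\boldsymbol H_1,\dots,\boldsymbol H_T$, and set $e_j^{(t)}=(\boldsymbol u_j^\top(\widehat{\boldsymbol w}_t^{(\mathrm{GR})}-\boldsymbol w_* ))^2$ for $t\ge1$ and $e_j^{(0)}=(\boldsymbol u_j^\top\boldsymbol w_* )^2$. (a) For all $j\in[p]$ and $t\in[T]$, $$\mathbb E[e_j^{(t)}]=\mathbb E[e_j^{(t-1)}]-2\,\frac{\gamma_j^{(t)}\,\mathbb E[e_j^{(t-1)}]}{\lambda_j^{(t)}+\gamma_j^{(t)}}+\frac{(\gamma_j^{(t)})^2\,\mathbb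 E[e_j^{(t-1)}]+\gamma_j^{(t)}\sigma^2/n_t}{(\lambda_j^{(t)}+\gamma_j^{(t)})^2}.$$ (b) Suppose that $e_j^{(0)}>0$ for all $j\in[p]$, and set $$\lambda_j^{(t)}=\frac{\sigma^2/e_j^{(0)}+\gamma_j^{(1)}n_1+\dots+\gamma_j^{(t-1)}n_{t-1}}{n_t}\qquad\text{for each } j\in[p],\ t\in[T].$$ Then for each $j$ and $t$ the right-hand side of the identity in (a), regarded as a function of $\lambda_j^{(t)}$ (over $\lambda_j^{(t)}>-\gamma_j^{(t)}$) with $\mathbb E[e_j^{(t-1)}]$ held fixed at the value resulting from this choice in the earlier tasks, is minimized at this value of $\lambda_j^{(t)}$; moreover, for all $j\in[p]$ and $t\in[T]$, $$\mathbb E[e_j^{(t)}]=\frac{\sigma^2}{\sigma^2/e_j^{(0)}+\gamma_j^{(1)}n_1+\dots+\gamma_j^{(t)}n_t},$$ and consequently $$\mathcal L(\widehat{\boldsymbol w}_t^{(\mathrm{GR})})=\sum_{j=1}^p\frac{\sigma^2}{\sigma^2/e_j^{(0)}+\gamma_j^{(1)}n_1+\dots+\gamma_j^{(t)}n_t}.$$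
   Context: Setting (continual linear regression). There are $T$ tasks. Task $t\in[T]=\{1,\dots,T\}$ has $n_t\ge1$ samples, a fixed (deterministic) design matrix $\boldsymbol X_t\in\mathbb R^{n_t\times p}$ and response vector $\boldsymbol y_t=\boldsymbol X_t\boldsymbol w_*+\boldsymbol\varepsilon_t\in\mathbb R^{n_t}$, where $\boldsymbol w_*\in\mathbb R^p$ is a fixed parameter common to all tasks, and the noise entries (over all samples and tasks) are independent with mean $0$ and variance $\sigma^2>0$. Put $\boldsymbol\Sigma_t=\boldsymbol X_t^\top\boldsymbol X_t/n_t\in\mathbb R^{p\times p}$. For an estimator $\widehat{\boldsymbol w}$, $\mathcal L(\widehat{\boldsymbol w})=\mathbb E\|\widehat{\boldsymbol w}-\boldsymbol w_*\|^2$ (Euclidean norm, expectation over the noise). Generalized $\ell_2$-regularized (GR) estimator with symmetric weight matrices $\boldsymbol H_1,\dots,\boldsymbol H_T\in\mathbb R^{p\times p}$: $\widehat{\boldsymbol w}_0^{(\mathrm{GR})}=0$ and, for $t\in[T]$, $$\widehat{\boldsymbol w}_t^{(\mathrm{GR})}=\arg\min_{\boldsymbol w\in\mathbb R^p}\Big\{\tfrac1{n_t}\|\boldsymbol X_t\boldsymbol w-\boldsymbol y_t\|^2+(\boldsymbol w-\widehat{\boldsymbol w}_{t-1}^{(\mathrm{GR})})^\top\boldsymbol H_t(\boldsymbol w-\widehat{\boldsymbol w}_{t-1}^{(\mathrm{GR})})\Big\},$$ which is uniquely defined when $\boldsymbol\Sigma_t+\boldsymbol H_t$ is positive definite. *)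

theory Defs
  imports "HOL-Probability.Probability"
begin

text \<open>
  The parameter space is \<open>real ^ 'p\<close>. Tasks are numbered by \<open>{1..T}\<close>; as the number \<open>n t\<close> of
  samples varies with the task, the \<open>n t \<times> p\<close> design matrix is given by its rows
  \<open>X t i :: real ^ 'p\<close> for \<open>i < n t\<close>, and vectors indexed by samples by their entries. Values
  at \<open>i \<ge> n t\<close> are never used.
\<close>

definition emp_cov :: "(nat \<Rightarrow> nat) \<Rightarrow> (nat \<Rightarrow> nat \<Rightarrow> real ^ 'p) \<Rightarrow> nat \<Rightarrow> real ^ 'p ^ 'p" where
  "emp_cov n X t = (\<chi> a b. (\<Sum>i<n t. X t i $ a * X t i $ b) / real (n t))"

definition diag_mat :: "('p \<Rightarrow> real) \<Rightarrow> real ^ 'p ^ 'p" where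
  "diag_mat d = (\<chi> a b. if a = b then d a else 0)"

definition response ::
  "(nat \<Rightarrow> nat \<Rightarrow> real ^ 'p) \<Rightarrow> real ^ 'p \<Rightarrow> (nat \<Rightarrow> nat \<Rightarrow> 'a \<Rightarrow> real) \<Rightarrow> 'a \<Rightarrow> nat \<Rightarrow> nat \<Rightarrow> real" where
  "response X wstar eps \<omega> t i = X t i \<bullet> wstar + eps t i \<omega>"

definition gr_objective ::
  "(nat \<Rightarrow> nat) \<Rightarrow> (nat \<Rightarrow> nat \<Rightarrow> real ^ 'p) \<Rightarrow> (nat \<Rightarrow> nat \<Rightarrow> real) \<Rightarrow> (nat \<Rightarrow> real ^ 'p ^ 'p) \<Rightarrow>
     nat \<Rightarrow> real ^ 'p \<Rightarrow> real ^ 'p \<Rightarrow> real" where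
  "gr_objective n X y H t v w =
     1 / real (n t) * (\<Sum>i<n t. (X t i \<bullet> w - y t i)\<^sup>2) + (w - v) \<bullet> (H t *v (w - v))"

primrec gr_estimator ::
  "(nat \<Rightarrow> nat) \<Rightarrow> (nat \<Rightarrow> nat \<Rightarrow> real ^ 'p) \<Rightarrow> (nat \<Rightarrow> nat \<Rightarrow> real) \<Rightarrow> (nat \<Rightarrow> real ^ 'p ^ 'p) \<Rightarrow>
     nat \<Rightarrow> real ^ 'p" where
  "gr_estimator n X y H 0 = 0"
| "gr_estimator n X y H (Suc t) =
     (ARG_MIN (gr_objective n X y H (Suc t) (gr_estimator n X y H t)) w. True)"

definition loss :: "'a measure \<Rightarrow> real ^ 'p \<Rightarrow> ('a \<Rightarrow> real ^ 'p) \<Rightarrow> real" where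
  "loss M wstar what = (\<integral>\<omega>. (norm (what \<omega> - wstar))\<^sup>2 \<partial>M)"

definition init_err :: "real ^ 'p ^ 'p \<Rightarrow> real ^ 'p \<Rightarrow> 'p \<Rightarrow> real" where
  "init_err U wstar j = (column j U \<bullet> wstar)\<^sup>2"

text \<open>
  \<open>coord_err U wstar what t j\<close> is the squared error of \<open>what t\<close> along the \<open>j\<close>-th column of \<open>U\<close>,
  where \<open>what t\<close> is the (random) estimator after task \<open>t\<close>.
\<close>

definition coord_err ::
  "real ^ 'p ^ 'p \<Rightarrow> real ^ 'p \<Rightarrow> (nat \<Rightarrow> 'a \<Rightarrow> real ^ 'p) \<Rightarrow> nat \<Rightarrow> 'p \<Rightarrow> 'a \<Rightarrow> real" where
  "coord_err U wstar what t j \<omega> =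
     (if t = 0 then init_err U wstar j else (column j U \<bullet> (what t \<omega> - wstar))\<^sup>2)"

definition mean_err ::
  "'a measure \<Rightarrow> real ^ 'p ^ 'p \<Rightarrow> real ^ 'p \<Rightarrow> (nat \<Rightarrow> 'a \<Rightarrow> real ^ 'p) \<Rightarrow> nat \<Rightarrow> 'p \<Rightarrow> real" where
  "mean_err M U wstar what t j = (\<integral>\<omega>. coord_err U wstar what t j \<omega> \<partial>M)"

text \<open>
  The one-step error recursion, with eigenvalue \<open>g\<close>, noise variance \<open>s2\<close>, sample size \<open>m\<close>,
  previous mean error \<open>E\<close>, and regularization weight \<open>l\<close>.
\<close>

definition err_step :: "real \<Rightarrow> real \<Rightarrow> nat \<Rightarrow> real \<Rightarrow> real \<Rightarrow> real" where
  "err_step g s2 m E l =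
     E - 2 * (g * E / (l + g)) + (g\<^sup>2 * E + g * s2 / real m) / (l + g)\<^sup>2"

end

theory Submission imports Defs begin

text \<open>
  In the orthonormal basis of the columns of \<open>U\<close> the objective of each task separates, so
  completing the square shows that the error \<open>D\<close> along a fixed column satisfies
  \<open>D\<^sub>t = (\<lambda>\<^sub>t D\<^sub>t\<^sub>-\<^sub>1 + z\<^sub>t) / (\<lambda>\<^sub>t + \<gamma>\<^sub>t)\<close>, where \<open>z\<^sub>t\<close> is a linear combination of the noise of task
  \<open>t\<close> with second moment \<open>\<gamma>\<^sub>t \<sigma>\<^sup>2 / n\<^sub>t\<close>. As \<open>D\<^sub>t\<^sub>-\<^sub>1\<close> is uncorrelated with the noise of later tasks,
  taking second moments gives (a). As a function of \<open>1 / (\<lambda>\<^sub>t + \<gamma>\<^sub>t)\<close> the right-hand side is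
  a parabola, whose vertex is \<open>\<lambda>\<^sub>t = \<sigma>\<^sup>2 / (n\<^sub>t E[D\<^sub>t\<^sub>-\<^sub>1\<^sup>2])\<close>; with this choice the reciprocal of the mean
  error increases by \<open>\<gamma>\<^sub>t n\<^sub>t / \<sigma>\<^sup>2\<close> in each step.
\<close>

section \<open>Coordinates along the columns of \<open>U\<close>\<close>

lemma diag_mat_mult_vec: "diag_mat d *v x = (\<chi> j. d j * x $ j)"
  by (simp add: diag_mat_def matrix_vector_mult_def vec_eq_iff if_distrib [of "\<lambda>c. c * _"] cong: if_cong)

lemma vec_mult_matrix_nth: "(x v* U) $ j = column j U \<bullet> x"
  for U :: "real ^ 'p ^ 'p"
  by (simp add: vector_matrix_mult_def column_def inner_vec_def mult.commute)

text \<open>Both factors of \<open>U\<close> are moved onto the arguments, leaving a diagonal form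
  in \<open>x v* U\<close> and \<open>y v* U\<close>. This is what decouples the columns in the
  objective.\<close>

lemma inner_spectral:
  "x \<bullet> ((U ** diag_mat d ** transpose U) *v y) = (\<Sum>j\<in>UNIV. d j * (column j U \<bullet> x) * (column j U \<bullet> y))"
  for U :: "real ^ 'p ^ 'p"
proof -
  have "x \<bullet> ((U ** diag_mat d ** transpose U) *v y) = (x v* U) \<bullet> (diag_mat d *v (y v* U))"
    by (metis dot_lmul_matrix transpose_matrix_vector matrix_vector_mul_assoc)
  also have "\<dots> = (\<Sum>j\<in>UNIV. d j * (column j U \<bullet> x) * (column j U \<bullet> y))"
    unfolding diag_mat_mult_vec by (simp add: inner_vec_def [of "x v* U"] vec_mult_matrix_nth mult_ac)
  finally show ?thesis .
qed

text \<open>Parseval: the spectral identity with all eigenvalues 1, as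
  \<open>U ** transpose U = mat 1\<close>.\<close>

lemma inner_columns_orthogonal:
  fixes U :: "real ^ 'p ^ 'p"
  assumes "orthogonal_matrix U"
  shows "x \<bullet> y = (\<Sum>j\<in>UNIV. (column j U \<bullet> x) * (column j U \<bullet> y))"
proof -
  have "diag_mat (\<lambda>_::'p. 1) = mat 1"
    by (simp add: diag_mat_def mat_def)
  then have "U ** diag_mat (\<lambda>_. 1) ** transpose U = mat 1"
    using assms by (simp add: orthogonal_matrix_def)
  then show ?thesis
    using inner_spectral [of x U "\<lambda>_. 1" y] by simp
qed

lemma column_mult_vec_orthogonal:
  fixes U :: "real ^ 'p ^ 'p"
  assumes "orthogonal_matrix U"
  shows "column j U \<bullet> (U *v x) = x $ j"
proof -
  have "transpose U *v (U *v x) = x"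
    using assms by (simp add: orthogonal_matrix_def matrix_vector_mul_assoc)
  then show ?thesis
    by (metis transpose_matrix_vector vec_mult_matrix_nth)
qed

text \<open>Bridge between samples and spectrum: for \<open>x = y\<close> this is the quadratic part
  of the least-squares term.\<close>

lemma inner_emp_cov:
  "x \<bullet> (emp_cov n X t *v y) = (\<Sum>i<n t. (X t i \<bullet> x) * (X t i \<bullet> y)) / real (n t)"
proof -
  have "x \<bullet> (emp_cov n X t *v y)
      = (\<Sum>a\<in>UNIV. \<Sum>b\<in>UNIV. \<Sum>i<n t. X t i $ a * x $ a * (X t i $ b * y $ b) / real (n t))"
    by (simp add: emp_cov_def matrix_vector_mult_def inner_vec_def sum_distrib_left
        sum_distrib_right sum_divide_distrib mult_ac)
  also have "\<dots> = (\<Sum>i<n t. \<Sum>a\<in>UNIV. \<Sum>b\<in>UNIV. X t i $ a * x $ a * (X t i $ b * y $ b) / real (n t))"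
    by (subst sum.swap [of _ "{..<n t}"], subst (2) sum.swap [of _ _ "{..<n t}"]) simp
  also have "\<dots> = (\<Sum>i<n t. (X t i \<bullet> x) * (X t i \<bullet> y)) / real (n t)"
    by (simp add: inner_vec_def sum_product sum_divide_distrib)
  finally show ?thesis .
qed

text \<open>As \<open>U\<close> is orthogonal, some displacement from \<open>w0\<close> has the
  coordinates \<open>m\<close>, so the lower bound \<open>C\<close> is attained; positive
  coefficients then make every square vanish at any minimizer.\<close>

lemma quadratic_arg_min_coordinates:
  fixes U :: "real ^ 'p ^ 'p"
  assumes U: "orthogonal_matrix U"
    and c: "\<And>j. c j > 0"
    and f: "\<And>w. f w = C + (\<Sum>j\<in>UNIV. c j * (column j U \<bullet> (w - w0) - m j)\<^sup>2)"
  shows "column j U \<bullet> ((ARG_MIN f w. True) - w0) = m j"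
proof -
  define w1 where "w1 = w0 + U *v (\<chi> j. m j)"
  have min: "f w1 = C"
    by (simp add: f w1_def column_mult_vec_orthogonal [OF U])
  have ge: "f w \<ge> C" for w
    using c by (simp add: f sum_nonneg less_imp_le)
  have "is_arg_min f (\<lambda>_. True) w1"
    using ge by (simp add: is_arg_min_def min not_less)
  \<comment> \<open>\<open>ARG_MIN\<close> is a Hilbert choice: it is known to be a minimizer only
    because \<open>w1\<close> shows that one exists.\<close>
  then have "is_arg_min f (\<lambda>_. True) (ARG_MIN f w. True)"
    unfolding arg_min_def by (rule someI)
  then have "f (ARG_MIN f w. True) = C"
    using ge min by (metis is_arg_min_def not_less order_antisym)
  then have "(\<Sum>j\<in>UNIV. c j * (column j U \<bullet> ((ARG_MIN f w. True) - w0) - m j)\<^sup>2) = 0"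
    by (simp add: f)
  then have "c j * (column j U \<bullet> ((ARG_MIN f w. True) - w0) - m j)\<^sup>2 = 0"
    using c by (subst (asm) sum_nonneg_eq_0_iff) (auto simp: less_imp_le)
  then show ?thesis
    using c [of j] by simp
qed

section \<open>Square-integrable random variables\<close>

text \<open>Measurability is a separate conjunct because integrability of the square does not imply
  it.\<close>

definition sq_integrable :: "'a measure \<Rightarrow> ('a \<Rightarrow> real) \<Rightarrow> bool" where
  "sq_integrable M f \<longleftrightarrow> f \<in> borel_measurable M \<and> integrable M (\<lambda>x. (f x)\<^sup>2)"

lemma sq_integrable_mult:
  assumes f: "sq_integrable M f" and g: "sq_integrable M g"
  shows "integrable M (\<lambda>x. f x * g x)"
proof (rule Bochner_Integration.integrable_bound)
  have [measurable]: "f \<in> borel_measurable M" "g \<in> borel_measurable M"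
    using f g by (simp_all add: sq_integrable_def)
  show "(\<lambda>x. f x * g x) \<in> borel_measurable M"
    by measurable
  show "integrable M (\<lambda>x. (f x)\<^sup>2 + (g x)\<^sup>2)"
    using f g by (simp add: sq_integrable_def)
  have "\<bar>a * b\<bar> \<le> a\<^sup>2 + b\<^sup>2" for a b :: real
    using sum_squares_bound [of "\<bar>a\<bar>" "\<bar>b\<bar>"] abs_ge_zero [of "a * b"]
    unfolding abs_mult power2_abs by linarith
  then show "AE x in M. norm (f x * g x) \<le> norm ((f x)\<^sup>2 + (g x)\<^sup>2)"
    by simp
qed

lemma sq_integrable_add:
  assumes f: "sq_integrable M f" and g: "sq_integrable M g"
  shows "sq_integrable M (\<lambda>x. f x + g x)"
proof -
  have [measurable]: "f \<in> borel_measurable M" "g \<in> borel_measurable M"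
    using f g by (simp_all add: sq_integrable_def)
  show ?thesis
    using f g sq_integrable_mult [OF f g] by (simp add: sq_integrable_def power2_sum mult.assoc)
qed

lemma sq_integrable_cmult:
  assumes "sq_integrable M f"
  shows "sq_integrable M (\<lambda>x. c * f x)"
proof -
  have [measurable]: "f \<in> borel_measurable M"
    using assms by (simp add: sq_integrable_def)
  show ?thesis
    using assms by (simp add: sq_integrable_def power_mult_distrib)
qed

lemma sq_integrable_sum:
  "(\<And>i. i \<in> A \<Longrightarrow> sq_integrable M (f i)) \<Longrightarrow> sq_integrable M (\<lambda>x. \<Sum>i\<in>A. f i x)"
  by (induction A rule: infinite_finite_induct)
     (simp_all add: sq_integrable_add, simp_all add: sq_integrable_def)

section \<open>Optimizing one step of the recursion\<close>

text \<open>In the variable \<open>1 / (l + g)\<close> the step is a parabola with leading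
  coefficient \<open>K\<close> and vertex \<open>1 / (l0 + g)\<close>. For \<open>g = 0\<close> it
  is constant, so the minimizer need not be unique.\<close>

lemma is_arg_min_err_step:
  assumes E: "E > 0" and s2: "s2 > 0" and m: "m > 0" and g: "g \<ge> 0"
  shows "is_arg_min (err_step g s2 m E) (\<lambda>l. l > - g) (s2 / (m * E))"
proof -
  define l0 where "l0 = s2 / (m * E)"
  have l0: "l0 > 0"
    using assms by (simp add: l0_def)
  define K where "K = g * E * (l0 + g)"
  have K: "K \<ge> 0"
    using assms l0 by (simp add: K_def)
  \<comment> \<open>This holds even at \<open>l = - g\<close>, where both sides follow the
    convention \<open>1 / 0 = 0\<close>.\<close>
  have *: "err_step g s2 m E l = E - K * (1 / (l0 + g))\<^sup>2 + K * (1 / (l + g) - 1 / (l0 + g))\<^sup>2" for l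
  proof -
    define \<theta> where "\<theta> = 1 / (l + g)"
    \<comment> \<open>The choice of \<open>l0\<close> turns the noise term into a multiple of
      \<open>E\<close>, so that the leading coefficient factors as \<open>K\<close>.\<close>
    have s: "s2 / m = l0 * E"
      using assms by (simp add: l0_def)
    have "err_step g s2 m E l = E - 2 * (g * E * \<theta>) + (g\<^sup>2 * E + g * (s2 / m)) * \<theta>\<^sup>2"
      by (simp add: err_step_def \<theta>_def power_divide)
    also have "\<dots> = E - 2 * (g * E * \<theta>) + g * E * (l0 + g) * \<theta>\<^sup>2"
      unfolding s by (simp add: algebra_simps power2_eq_square)
    also have "\<dots> = E - K * (1 / (l0 + g))\<^sup>2 + K * (\<theta> - 1 / (l0 + g))\<^sup>2"
    proof -
      define a where "a = l0 + g"
      have "a > 0" using l0 g by (simp add: a_def)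
      then show ?thesis
        unfolding K_def a_def [symmetric] by (simp add: field_simps power2_eq_square)
    qed
    finally show ?thesis by (simp add: \<theta>_def)
  qed
  have "err_step g s2 m E l0 \<le> err_step g s2 m E l" for l
    using K by (simp add: *)
  then show ?thesis
    using l0 g by (auto simp: is_arg_min_def not_less simp flip: l0_def)
qed

text \<open>With \<open>a = l + g\<close>, the terms in \<open>E\<close> form the square of
  \<open>1 - g / a = l / a\<close>: old error shrunk, plus fresh noise.\<close>

lemma err_step_eq:
  assumes "l + g \<noteq> 0"
  shows "err_step g s2 m E l = (l\<^sup>2 * E + g * s2 / real m) / (l + g)\<^sup>2"
proof -
  define a where "a = l + g"
  have "a \<noteq> 0" using assms by (simp add: a_def)
  then have "E - 2 * (g * E / a) + (g\<^sup>2 * E + r) / a\<^sup>2 = ((a - g)\<^sup>2 * E + r) / a\<^sup>2" for r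
    by (simp add: field_simps power2_eq_square)
  then show ?thesis
    by (simp add: err_step_def a_def)
qed

text \<open>Here \<open>q\<close> is \<open>s2\<close> over the current mean error. The numerator
  becomes \<open>s2 * a / m^2\<close> with \<open>a = q + g * m\<close>, and one of the two factors
  \<open>a\<close> in the denominator cancels.\<close>

lemma err_step_optimal:
  assumes "q > 0" "s2 > 0" "m > 0" "g \<ge> 0"
  shows "err_step g s2 m (s2 / q) (q / real m) = s2 / (q + g * real m)"
proof -
  define a where "a = q + g * real m"
  have a: "a > 0"
    using assms by (simp add: a_def add_pos_nonneg)
  have qa: "q / real m + g = a / real m"
    using assms by (simp add: a_def field_simps)
  have "err_step g s2 m (s2 / q) (q / m) = ((q / m)\<^sup>2 * (s2 / q) + g * s2 / m) / (a / real m)\<^sup>2"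
    using a assms by (subst err_step_eq) (auto simp: qa)
  also have "(q / m)\<^sup>2 * (s2 / q) + g * s2 / m = s2 * a / (real m)\<^sup>2"
    using assms by (simp add: a_def field_simps power2_eq_square)
  finally show ?thesis
    using assms a by (simp add: power2_eq_square flip: a_def)
qed

section \<open>Coordinates of the minimizer of one task\<close>

text \<open>The columns are orthonormal, so the Rayleigh quotient at a column is its
  eigenvalue.\<close>

lemma inner_spectral_column:
  fixes U :: "real ^ 'p ^ 'p"
  assumes "orthogonal_matrix U"
  shows "column j U \<bullet> ((U ** diag_mat d ** transpose U) *v column j U) = d j"
proof -
  have "column k U \<bullet> column j U = (if k = j then 1 else 0)" for k
    using column_mult_vec_orthogonal [OF assms, of k "axis j 1"]
    by (simp add: matrix_vector_mult_basis) (simp add: axis_def)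
  then have "column j U \<bullet> ((U ** diag_mat d ** transpose U) *v column j U)
      = (\<Sum>k\<in>UNIV. if k = j then d k else 0)"
    unfolding inner_spectral by (intro sum.cong) auto
  then show ?thesis by simp
qed

text \<open>In terms of \<open>w - wstar\<close>, fit and penalty are sums of one-variable
  quadratics over the columns; completing each square puts its vertex at \<open>m k\<close>, and
  \<open>C\<close> collects everything free of \<open>w\<close>.\<close>

lemma gr_objective_arg_min_coordinates:
  fixes U :: "real ^ 'p ^ 'p"
  assumes U: "orthogonal_matrix U"
    and cov: "emp_cov n X t = U ** diag_mat g ** transpose U"
    and H: "H t = U ** diag_mat l ** transpose U"
    and pos: "\<And>j. l j + g j > 0"
  shows "column j U \<bullet> ((ARG_MIN (gr_objective n X (response X wstar eps \<omega>) H t v) w. True) - wstar)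
      = l j / (l j + g j) * (column j U \<bullet> (v - wstar))
        + (\<Sum>i<n t. (column j U \<bullet> X t i) / (real (n t) * (l j + g j)) * eps t i \<omega>)"
proof -
  define u where "u k = column k U" for k
  define z where "z k = (\<Sum>i<n t. (u k \<bullet> X t i) * eps t i \<omega>) / real (n t)" for k
  define b where "b k = u k \<bullet> (v - wstar)" for k
  define m where "m k = (l k * b k + z k) / (l k + g k)" for k
  define C where "C = (\<Sum>i<n t. (eps t i \<omega>)\<^sup>2) / real (n t)
    + (\<Sum>k\<in>UNIV. l k * (b k)\<^sup>2 - (l k + g k) * (m k)\<^sup>2)"
  have "gr_objective n X (response X wstar eps \<omega>) H t v w
      = C + (\<Sum>k\<in>UNIV. (l k + g k) * (u k \<bullet> (w - wstar) - m k)\<^sup>2)" for w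
  proof -
    define d where "d = w - wstar"
    have res: "X t i \<bullet> w - response X wstar eps \<omega> t i = X t i \<bullet> d - eps t i \<omega>" for i
      by (simp add: response_def d_def inner_diff_right)
    have "(\<Sum>i<n t. (X t i \<bullet> w - response X wstar eps \<omega> t i)\<^sup>2) / real (n t)
        = d \<bullet> (emp_cov n X t *v d) - 2 * ((\<Sum>i<n t. (X t i \<bullet> d) * eps t i \<omega>) / real (n t))
          + (\<Sum>i<n t. (eps t i \<omega>)\<^sup>2) / real (n t)"
      unfolding res inner_emp_cov
      by (simp add: power2_diff sum.distrib sum_subtractf add_divide_distrib diff_divide_distrib
          sum_distrib_left mult.assoc flip: power2_eq_square)
    also have "d \<bullet> (emp_cov n X t *v d) = (\<Sum>k\<in>UNIV. g k * (u k \<bullet> d)\<^sup>2)"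
      by (simp add: cov inner_spectral u_def power2_eq_square mult.assoc)
    also have "(\<Sum>i<n t. (X t i \<bullet> d) * eps t i \<omega>) / real (n t) = (\<Sum>k\<in>UNIV. (u k \<bullet> d) * z k)"
    proof -
      have "(\<Sum>i<n t. (X t i \<bullet> d) * eps t i \<omega>)
          = (\<Sum>i<n t. \<Sum>k\<in>UNIV. (u k \<bullet> d) * ((u k \<bullet> X t i) * eps t i \<omega>))"
        by (subst inner_columns_orthogonal [OF U]) (simp add: sum_distrib_left u_def mult_ac)
      also have "\<dots> = (\<Sum>k\<in>UNIV. (u k \<bullet> d) * (\<Sum>i<n t. (u k \<bullet> X t i) * eps t i \<omega>))"
        by (subst sum.swap) (simp add: sum_distrib_left)
      finally show ?thesis
        by (simp add: z_def sum_divide_distrib [of _ UNIV])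
    qed
    finally have fit: "(\<Sum>i<n t. (X t i \<bullet> w - response X wstar eps \<omega> t i)\<^sup>2) / real (n t)
        = (\<Sum>k\<in>UNIV. g k * (u k \<bullet> d)\<^sup>2 - 2 * ((u k \<bullet> d) * z k))
          + (\<Sum>i<n t. (eps t i \<omega>)\<^sup>2) / real (n t)"
      by (simp add: sum_subtractf sum_distrib_left)
    have pen: "(w - v) \<bullet> (H t *v (w - v)) = (\<Sum>k\<in>UNIV. l k * (u k \<bullet> d - b k)\<^sup>2)"
      by (simp add: H inner_spectral b_def d_def u_def power2_eq_square mult.assoc flip: inner_diff_right)
    have square: "g k * x\<^sup>2 - 2 * (x * z k) + l k * (x - b k)\<^sup>2
        = l k * (b k)\<^sup>2 - (l k + g k) * (m k)\<^sup>2 + (l k + g k) * (x - m k)\<^sup>2" for k x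
    proof -
      \<comment> \<open>Eliminating \<open>z k\<close> through the vertex equation leaves a
        polynomial identity without division.\<close>
      have "(l k + g k) * m k = l k * b k + z k"
        using pos [of k] by (simp add: m_def)
      then have z: "z k = (l k + g k) * m k - l k * b k"
        by simp
      show ?thesis
        unfolding z by (simp add: power2_eq_square algebra_simps)
    qed
    show ?thesis
      unfolding gr_objective_def d_def [symmetric] C_def pen
      using fit by (simp add: square flip: sum.distrib add.assoc)
  qed
  then have "column j U \<bullet> ((ARG_MIN (gr_objective n X (response X wstar eps \<omega>) H t v) w. True) - wstar) = m j"
    unfolding u_def using pos by (rule quadratic_arg_min_coordinates [OF U, rotated])
  also have "m j = l j / (l j + g j) * b j + z j / (l j + g j)"
    by (simp add: m_def add_divide_distrib)
  also have "z j / (l j + g j) = (\<Sum>i<n t. (column j U \<bullet> X t i) / (real (n t) * (l j + g j)) * eps t i \<omega>)"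
    by (simp add: z_def u_def sum_divide_distrib)
  finally show ?thesis
    by (simp add: b_def u_def)
qed

section \<open>Second moments of linear combinations\<close>

text \<open>The product rule for independent families is applied to the subfamily
  \<open>{i, k}\<close>. With mean zero it makes distinct noise entries uncorrelated, within a task
  and across tasks.\<close>

lemma (in prob_space) indep_vars_expectation_mult:
  fixes X :: "'i \<Rightarrow> 'a \<Rightarrow> real"
  assumes "indep_vars (\<lambda>_. borel) X I" "i \<in> I" "k \<in> I" "i \<noteq> k"
    and "integrable M (X i)" "integrable M (X k)"
  shows "expectation (\<lambda>\<omega>. X i \<omega> * X k \<omega>) = expectation (X i) * expectation (X k)"
proof -
  have "indep_vars (\<lambda>_. borel) X {i, k}"
    using assms by (auto intro: indep_vars_subset)
  then have "expectation (\<lambda>\<omega>. \<Prod>a\<in>{i, k}. X a \<omega>) = (\<Prod>a\<in>{i, k}. expectation (X a))"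
    using assms by (intro indep_vars_lebesgue_integral) auto
  then show ?thesis
    using \<open>i \<noteq> k\<close> by simp
qed

lemma integral_linear_mult:
  fixes a :: real
  assumes D: "sq_integrable M D" and e: "\<And>i. i \<in> A \<Longrightarrow> sq_integrable M (e i)"
    and f: "sq_integrable M f"
  shows "(\<integral>x. (a * D x + (\<Sum>i\<in>A. c i * e i x)) * f x \<partial>M)
      = a * (\<integral>x. D x * f x \<partial>M) + (\<Sum>i\<in>A. c i * (\<integral>x. e i x * f x \<partial>M))"
proof -
  have "(\<integral>x. (a * D x + (\<Sum>i\<in>A. c i * e i x)) * f x \<partial>M)
      = (\<integral>x. a * (D x * f x) + (\<Sum>i\<in>A. c i * (e i x * f x)) \<partial>M)"
    by (simp add: distrib_right sum_distrib_right mult.assoc)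
  also have "\<dots> = (\<integral>x. a * (D x * f x) \<partial>M) + (\<integral>x. (\<Sum>i\<in>A. c i * (e i x * f x)) \<partial>M)"
    by (intro Bochner_Integration.integral_add Bochner_Integration.integrable_sum
        integrable_mult_right sq_integrable_mult D e f)
  also have "(\<integral>x. (\<Sum>i\<in>A. c i * (e i x * f x)) \<partial>M) = (\<Sum>i\<in>A. \<integral>x. c i * (e i x * f x) \<partial>M)"
    by (intro Bochner_Integration.integral_sum integrable_mult_right sq_integrable_mult e f)
  finally show ?thesis by simp
qed

text \<open>One factor \<open>Y\<close> of the square is expanded at a time, so linearity is used
  first against \<open>Y\<close>, then against \<open>D\<close> and each \<open>e i\<close>, and no
  double sum arises.\<close>

lemma integral_linear_square:
  fixes a :: real
  assumes D: "sq_integrable M D" and e: "\<And>i. i \<in> A \<Longrightarrow> sq_integrable M (e i)"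
    and A: "finite A"
    and De: "\<And>i. i \<in> A \<Longrightarrow> (\<integral>x. D x * e i x \<partial>M) = 0"
    and ee: "\<And>i k. i \<in> A \<Longrightarrow> k \<in> A \<Longrightarrow> (\<integral>x. e i x * e k x \<partial>M) = (if i = k then v else 0)"
  shows "(\<integral>x. (a * D x + (\<Sum>i\<in>A. c i * e i x))\<^sup>2 \<partial>M)
      = a\<^sup>2 * (\<integral>x. (D x)\<^sup>2 \<partial>M) + v * (\<Sum>i\<in>A. (c i)\<^sup>2)"
proof -
  define Y where "Y x = a * D x + (\<Sum>i\<in>A. c i * e i x)" for x
  have Y: "sq_integrable M Y"
    unfolding Y_def by (intro sq_integrable_add sq_integrable_sum sq_integrable_cmult D e)
  have DY: "(\<integral>x. D x * Y x \<partial>M) = a * (\<integral>x. (D x)\<^sup>2 \<partial>M)"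
    using integral_linear_mult [OF D e D, where a = a and c = c] De
    by (simp add: Y_def mult.commute power2_eq_square)
  have eY: "(\<integral>x. e i x * Y x \<partial>M) = v * c i" if "i \<in> A" for i
  proof -
    have "(\<integral>x. Y x * e i x \<partial>M) = (\<Sum>k\<in>A. c k * (if k = i then v else 0))"
      using integral_linear_mult [OF D e e, where a = a and c = c] De ee that by (simp add: Y_def)
    also have "\<dots> = v * c i"
      using A that by (simp add: if_distrib [of "\<lambda>y. _ * y"] mult.commute cong: if_cong)
    finally show ?thesis by (simp add: mult.commute)
  qed
  have "(\<integral>x. (Y x)\<^sup>2 \<partial>M) = a * (\<integral>x. D x * Y x \<partial>M) + (\<Sum>i\<in>A. c i * (\<integral>x. e i x * Y x \<partial>M))"
    using integral_linear_mult [OF D e Y, where a = a and c = c] by (simp add: Y_def power2_eq_square)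
  also have "\<dots> = a\<^sup>2 * (\<integral>x. (D x)\<^sup>2 \<partial>M) + v * (\<Sum>i\<in>A. (c i)\<^sup>2)"
    by (simp add: DY eY) (simp add: power2_eq_square sum_distrib_left mult_ac)
  finally show ?thesis
    unfolding Y_def .
qed

section \<open>Error recursion, optimal weights and loss\<close>

theorem theorem4p2:
  fixes M :: "'a measure"
    and T :: nat
    and n :: "nat \<Rightarrow> nat"
    and X :: "nat \<Rightarrow> nat \<Rightarrow> real ^ 'p"
    and wstar :: "real ^ 'p"
    and eps :: "nat \<Rightarrow> nat \<Rightarrow> 'a \<Rightarrow> real"
    and \<sigma> :: real
    and U :: "real ^ 'p ^ 'p"
    and \<gamma> lam :: "nat \<Rightarrow> 'p \<Rightarrow> real"
    and H :: "nat \<Rightarrow> real ^ 'p ^ 'p"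
    and what :: "nat \<Rightarrow> 'a \<Rightarrow> real ^ 'p"
  assumes prob: "prob_space M"
    and samples: "\<And>t. t \<in> {1..T} \<Longrightarrow> n t \<ge> 1"
    and indep: "prob_space.indep_vars M (\<lambda>_. borel) (\<lambda>(t, i). eps t i) (SIGMA t:{1..T}. {..<n t})"
    and noise_int: "\<And>t i. t \<in> {1..T} \<Longrightarrow> i < n t \<Longrightarrow> integrable M (eps t i)"
    and noise_sq_int: "\<And>t i. t \<in> {1..T} \<Longrightarrow> i < n t \<Longrightarrow> integrable M (\<lambda>\<omega>. (eps t i \<omega>)\<^sup>2)"
    and noise_mean: "\<And>t i. t \<in> {1..T} \<Longrightarrow> i < n t \<Longrightarrow> prob_space.expectation M (eps t i) = 0"
    and noise_var: "\<And>t i. t \<in> {1..T} \<Longrightarrow> i < n t \<Longrightarrow> prob_space.variance M (eps t i) = \<sigma>\<^sup>2"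
    and sigma_pos: "\<sigma>\<^sup>2 > 0"
    and commute: "\<And>s t. s \<in> {1..T} \<Longrightarrow> t \<in> {1..T} \<Longrightarrow>
                    emp_cov n X s ** emp_cov n X t = emp_cov n X t ** emp_cov n X s"
    and orth: "orthogonal_matrix U"
    and spectral: "\<And>t. t \<in> {1..T} \<Longrightarrow> emp_cov n X t = U ** diag_mat (\<gamma> t) ** transpose U"
    and gamma_sum: "\<And>j. (\<Sum>t=1..T. \<gamma> t j) > 0"
    and weights: "\<And>t. t \<in> {1..T} \<Longrightarrow> H t = U ** diag_mat (lam t) ** transpose U"
    and estimator: "\<And>t \<omega>. what t \<omega> = gr_estimator n X (response X wstar eps \<omega>) H t"
  shows
    "((\<forall>t\<in>{1..T}. \<forall>j. lam t j + \<gamma> t j > 0) \<longrightarrow>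
       (\<forall>t\<in>{1..T}. \<forall>j.
          integrable M (coord_err U wstar what t j) \<and>
          mean_err M U wstar what t j =
            err_step (\<gamma> t j) (\<sigma>\<^sup>2) (n t) (mean_err M U wstar what (t - 1) j) (lam t j)))
     \<and>
     ((\<forall>j. init_err U wstar j > 0) \<and>
     (\<forall>t\<in>{1..T}. \<forall>j. lam t j =
        (\<sigma>\<^sup>2 / init_err U wstar j + (\<Sum>s\<in>{1..<t}. \<gamma> s j * real (n s))) / real (n t)) \<longrightarrow>
       (\<forall>t\<in>{1..T}. \<forall>j.
          is_arg_min (err_step (\<gamma> t j) (\<sigma>\<^sup>2) (n t) (mean_err M U wstar what (t - 1) j))
                     (\<lambda>l. l > - \<gamma> t j) (lam t j)) \<and>
       (\<forall>t\<in>{1..T}. \<forall>j. mean_err M U wstar what t j =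
          \<sigma>\<^sup>2 / (\<sigma>\<^sup>2 / init_err U wstar j + (\<Sum>s\<in>{1..t}. \<gamma> s j * real (n s)))) \<and>
       (\<forall>t\<in>{1..T}. loss M wstar (what t) =
          (\<Sum>j\<in>UNIV. \<sigma>\<^sup>2 / (\<sigma>\<^sup>2 / init_err U wstar j + (\<Sum>s\<in>{1..t}. \<gamma> s j * real (n s))))))"
proof -
  interpret prob_space M by (fact prob)
  define D where "D t j \<omega> = column j U \<bullet> (what t \<omega> - wstar)" for t j \<omega>
  have n_pos: "n t > 0" if "t \<in> {1..T}" for t
    using samples [OF that] by simp
  \<comment> \<open>At \<open>t = 0\<close> the two branches agree: the initial estimator is zero
    and squaring removes the sign.\<close>
  have coord: "coord_err U wstar what t j = (\<lambda>\<omega>. (D t j \<omega>)\<^sup>2)" for t j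
    by (auto simp: coord_err_def init_err_def D_def estimator)
  have mean_err_0: "mean_err M U wstar what 0 j = init_err U wstar j" for j
    by (simp add: mean_err_def coord_err_def prob_space)
  have eps_sq: "sq_integrable M (eps t i)" if "t \<in> {1..T}" "i < n t" for t i
    using noise_int [OF that] noise_sq_int [OF that] by (simp add: sq_integrable_def)
  have eps_corr: "(\<integral>\<omega>. eps t i \<omega> * eps s k \<omega> \<partial>M) = (if (t, i) = (s, k) then \<sigma>\<^sup>2 else 0)"
    if "t \<in> {1..T}" "i < n t" "s \<in> {1..T}" "k < n s" for t i s k
  proof (cases "(t, i) = (s, k)")
    case True
    then show ?thesis
      using noise_var [OF that(1,2)] noise_mean [OF that(1,2)] by (simp add: power2_eq_square)
  next
    case False
    then show ?thesis
      using indep_vars_expectation_mult [OF indep, of "(t, i)" "(s, k)"] that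
      by (auto simp: noise_int noise_mean)
  qed
  \<comment> \<open>The Rayleigh quotient of the covariance at a column of \<open>U\<close>. It
    fixes the variance of the projected noise and the sign of the eigenvalues.\<close>
  have col_sq: "(\<Sum>i<n t. (column j U \<bullet> X t i)\<^sup>2) = real (n t) * \<gamma> t j" if "t \<in> {1..T}" for t j
    using inner_emp_cov [of "column j U" n X t "column j U"] n_pos [OF that]
    by (simp add: spectral [OF that] inner_spectral_column [OF orth] inner_commute
        power2_eq_square field_simps)
  have \<gamma>_nonneg: "\<gamma> t j \<ge> 0" if "t \<in> {1..T}" for t j
    using col_sq [OF that, of j] n_pos [OF that]
    by (metis sum_nonneg zero_le_power2 zero_le_mult_iff of_nat_0_less_iff not_less)

  have recursion: "integrable M (coord_err U wstar what t j) \<and>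
      mean_err M U wstar what t j =
        err_step (\<gamma> t j) (\<sigma>\<^sup>2) (n t) (mean_err M U wstar what (t - 1) j) (lam t j)"
    if pos: "\<forall>t\<in>{1..T}. \<forall>j. lam t j + \<gamma> t j > 0" and t: "t \<in> {1..T}" for t j
  proof -
    \<comment> \<open>\<open>a\<close> is the shrinkage of the previous error and \<open>c\<close>
      holds the weights of the noise entries in the new one.\<close>
    define a where "a t = lam t j / (lam t j + \<gamma> t j)" for t
    define c where "c t i = (column j U \<bullet> X t i) / (real (n t) * (lam t j + \<gamma> t j))" for t i
    have D_Suc: "D (Suc t) j = (\<lambda>\<omega>. a (Suc t) * D t j \<omega> + (\<Sum>i<n (Suc t). c (Suc t) i * eps (Suc t) i \<omega>))"
      if "Suc t \<in> {1..T}" for t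
    proof
      fix \<omega>
      show "D (Suc t) j \<omega> = a (Suc t) * D t j \<omega> + (\<Sum>i<n (Suc t). c (Suc t) i * eps (Suc t) i \<omega>)"
        unfolding D_def estimator gr_estimator.simps a_def c_def
        using that pos by (intro gr_objective_arg_min_coordinates orth spectral weights) auto
    qed
    \<comment> \<open>The induction carries all later tasks \<open>s\<close>: the noise of a task
      must stay uncorrelated with the error through every earlier step.\<close>
    have inv: "sq_integrable M (D t j) \<and>
        (\<forall>s\<in>{t<..T}. \<forall>k<n s. (\<integral>\<omega>. D t j \<omega> * eps s k \<omega> \<partial>M) = 0)" if "t \<le> T" for t
      using that
    proof (induction t)
      case 0
      have "D 0 j = (\<lambda>\<omega>. - (column j U \<bullet> wstar))"
        by (simp add: D_def estimator fun_eq_iff)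
      then show ?case
        using noise_mean by (auto simp: sq_integrable_def)
    next
      case (Suc t)
      then have IH: "sq_integrable M (D t j)"
          "\<And>s k. s \<in> {t<..T} \<Longrightarrow> k < n s \<Longrightarrow> (\<integral>\<omega>. D t j \<omega> * eps s k \<omega> \<partial>M) = 0"
        and Suc_t: "Suc t \<in> {1..T}"
        by auto
      have "sq_integrable M (D (Suc t) j)"
        unfolding D_Suc [OF Suc_t] using Suc_t
        by (intro sq_integrable_add sq_integrable_sum sq_integrable_cmult IH(1) eps_sq) auto
      moreover have "(\<integral>\<omega>. D (Suc t) j \<omega> * eps s k \<omega> \<partial>M) = 0" if "s \<in> {Suc t<..T}" "k < n s" for s k
        unfolding D_Suc [OF Suc_t] using Suc_t that
        by (subst integral_linear_mult [OF IH(1)]) (auto simp: eps_sq eps_corr IH(2))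
      ultimately show ?case
        by blast
    qed
    obtain r where r: "t = Suc r"
      using t by (cases t) auto
    have sq: "sq_integrable M (D t j)"
      using inv t by simp
    have "(\<integral>\<omega>. (D t j \<omega>)\<^sup>2 \<partial>M) = (a t)\<^sup>2 * (\<integral>\<omega>. (D r j \<omega>)\<^sup>2 \<partial>M) + \<sigma>\<^sup>2 * (\<Sum>i<n t. (c t i)\<^sup>2)"
      using D_Suc [of r] inv [of r] t unfolding r
      by (simp, intro integral_linear_square) (auto simp: eps_sq eps_corr)
    \<comment> \<open>By \<open>col_sq\<close> the numerators sum to
      \<open>n t * \<gamma> t j\<close>, which cancels one of the two factors \<open>n t\<close>
      below.\<close>
    also have "(\<Sum>i<n t. (c t i)\<^sup>2) = \<gamma> t j / real (n t) / (lam t j + \<gamma> t j)\<^sup>2"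
      using n_pos [OF t]
      by (simp add: c_def power_divide col_sq [OF t] flip: sum_divide_distrib)
         (simp add: power2_eq_square mult_ac)
    also have "(a t)\<^sup>2 * (\<integral>\<omega>. (D r j \<omega>)\<^sup>2 \<partial>M) + \<sigma>\<^sup>2 * (\<gamma> t j / real (n t) / (lam t j + \<gamma> t j)\<^sup>2)
        = err_step (\<gamma> t j) (\<sigma>\<^sup>2) (n t) (\<integral>\<omega>. (D r j \<omega>)\<^sup>2 \<partial>M) (lam t j)"
      using pos t
      by (subst err_step_eq) (auto simp: a_def power_divide add_divide_distrib mult_ac less_imp_neq [THEN not_sym])
    finally show ?thesis
      using sq by (simp add: mean_err_def coord r sq_integrable_def)
  qed

  have closed_form:
    "is_arg_min (err_step (\<gamma> t j) (\<sigma>\<^sup>2) (n t) (mean_err M U wstar what (t - 1) j)) (\<lambda>l. l > - \<gamma> t j) (lam t j)"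
    "mean_err M U wstar what t j = \<sigma>\<^sup>2 / (\<sigma>\<^sup>2 / init_err U wstar j + (\<Sum>s\<in>{1..t}. \<gamma> s j * real (n s)))"
    "integrable M (coord_err U wstar what t j)"
    if init: "\<forall>j. init_err U wstar j > 0"
      and lam: "\<forall>t\<in>{1..T}. \<forall>j. lam t j =
        (\<sigma>\<^sup>2 / init_err U wstar j + (\<Sum>s\<in>{1..<t}. \<gamma> s j * real (n s))) / real (n t)"
      and t: "t \<in> {1..T}"
    for t j
  proof -
    \<comment> \<open>\<open>q t j\<close> will be \<sigma>^2 over the mean error; at
      \<open>t = 0\<close> the sum is empty and this is true by definition.\<close>
    define q where "q t j = \<sigma>\<^sup>2 / init_err U wstar j + (\<Sum>s\<in>{1..t}. \<gamma> s j * real (n s))" for t j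
    have q_pos: "q t j > 0" if "t \<le> T" for t j
      using init sigma_pos that
      by (auto simp: q_def \<gamma>_nonneg intro!: add_pos_nonneg sum_nonneg)
    \<comment> \<open>The index shifts by one: the sum in the weight of a task stops just before
      that task.\<close>
    have lam_q: "lam (Suc t) j = q t j / real (n (Suc t))" if "Suc t \<in> {1..T}" for t j
      using lam that by (simp add: q_def atLeastLessThanSuc_atLeastAtMost)
    \<comment> \<open>The prescribed weights are admissible, so the recursion of the first claim
      applies to them.\<close>
    have pos: "\<forall>t\<in>{1..T}. \<forall>j. lam t j + \<gamma> t j > 0"
    proof (intro ballI allI)
      fix t j assume t: "t \<in> {1..T}"
      then obtain r where r: "t = Suc r"
        by (cases t) auto
      show "lam t j + \<gamma> t j > 0"
        using lam_q [of r j] q_pos [of r j] n_pos [of t] \<gamma>_nonneg [of t j] t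
        by (simp add: r add_pos_nonneg)
    qed
    have step: "err_step (\<gamma> (Suc t) j) (\<sigma>\<^sup>2) (n (Suc t)) (\<sigma>\<^sup>2 / q t j) (lam (Suc t) j) = \<sigma>\<^sup>2 / q (Suc t) j"
      if "Suc t \<in> {1..T}" for t
      using that sigma_pos err_step_optimal [of "q t j" "\<sigma>\<^sup>2" "n (Suc t)" "\<gamma> (Suc t) j"]
      by (simp add: lam_q q_pos n_pos \<gamma>_nonneg) (simp add: q_def add.assoc)
    have mean: "mean_err M U wstar what t j = \<sigma>\<^sup>2 / q t j" if "t \<le> T" for t
      using that
    proof (induction t)
      case 0
      then show ?case
        using init sigma_pos by (simp add: mean_err_0 q_def)
    next
      case (Suc t)
      then show ?case
        using recursion [OF pos, of "Suc t" j] step [of t] by simp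
    qed
    show "mean_err M U wstar what t j = \<sigma>\<^sup>2 / (\<sigma>\<^sup>2 / init_err U wstar j + (\<Sum>s\<in>{1..t}. \<gamma> s j * real (n s)))"
      using mean t by (simp add: q_def)
    show "integrable M (coord_err U wstar what t j)"
      using recursion [OF pos t] by simp
    obtain r where r: "t = Suc r"
      using t by (cases t) auto
    \<comment> \<open>The vertex of the parabola for the mean error
      \<open>\<sigma>\<^sup>2 / q r j\<close> is exactly the prescribed weight.\<close>
    have "\<sigma>\<^sup>2 / (real (n t) * (\<sigma>\<^sup>2 / q r j)) = lam t j"
      using t sigma_pos by (simp add: r lam_q)
    then show "is_arg_min (err_step (\<gamma> t j) (\<sigma>\<^sup>2) (n t) (mean_err M U wstar what (t - 1) j)) (\<lambda>l. l > - \<gamma> t j) (lam t j)"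
      using is_arg_min_err_step [of "\<sigma>\<^sup>2 / q r j" "\<sigma>\<^sup>2" "n t" "\<gamma> t j"] t sigma_pos
      by (simp add: r mean q_pos n_pos \<gamma>_nonneg)
  qed

  \<comment> \<open>Parseval holds pointwise; integrability of each term lets the expectation pass
    through the sum.\<close>
  have loss_eq: "loss M wstar (what t) = (\<Sum>j\<in>UNIV. mean_err M U wstar what t j)"
    if "\<And>j. integrable M (coord_err U wstar what t j)" for t
  proof -
    have "(norm (what t \<omega> - wstar))\<^sup>2 = (\<Sum>j\<in>UNIV. coord_err U wstar what t j \<omega>)" for \<omega>
      unfolding coord D_def power2_norm_eq_inner
      by (subst inner_columns_orthogonal [OF orth]) (simp add: power2_eq_square)
    then show ?thesis
      using that by (simp add: loss_def mean_err_def)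
  qed
  show ?thesis
    using recursion closed_form by (simp add: loss_eq)
qed

end
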